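(* Let $\mathcal{U}$ be a nice cover of $\mathbb{R}$ and let $\mathscr{F}$ be a cosheaf on $\mathbb{R}$. Then $$d_I(\mathscr{F},\mathcal{M}_\mathcal{U}(\mathscr{F}))\le \operatorname{res}_{\mathscr{F}}\mathcal{U}.$$
   Context: Let $\mathbf{Int}$ be the category whose objects are the (nonempty) connected open subsets of $\mathbb{R}$ ("open intervals", possibly unbounded) and whose morphisms are inclusions, and let $\mathbf{Set}$ be the category of sets. A pre-cosheaf on $\mathbb{R}$ is a covariant functor $\mathscr{F}:\mathbf{Int}\to\mathbf{Set}$; write $\mathscr{F}[U\subset V]:\mathscr{F}(U)\to\mathscr{F}(V)$ for its structure maps. A pre-cosheaf is a cosheaf if for each open interval $U$ and each cover $\mathcal{V}\subset\mathbf{Int}$ of $U$ by open intervals which is closed under (nonempty) finite intersections, the canonical map $\varinjlim_{V\in\mathcal{V}}\mathscr{F}(V)\to\mathscr{F}(U)$ is an isomorphism. A nice cover of $\mathbb{R}$ is an open cover $\mathcal{U}$ consisting of open intervals, which is good (all nonempty intersections are contractible) and locally finite (for every $x\in\mathbb{R}$ the set $\mathcal{U}_x=\{V\in\mathcal{U}: x\in V\}$ is finite). For an open interval $U$ put $\mathcal{I}_\mathcal{U}(U)=\bigcup_{x\in U}\bigcap_{V\in\mathcal{U}_x}V\subset\mathbb{R}$, which is again an open interval, and $U\subset V$ implies $\mathcal{I}_\mathcal{U}(U)\subset\mathcal{I}_\mathcal{U}(V)$. The mapper functor $\mathcal{M}_\mathcal{U}$ sends a pre-cosheaf $\mathscr{C}$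 to the pre-cosheaf $\mathcal{M}_\mathcal{U}(\mathscr{C})(U):=\mathscr{C}(\mathcal{I}_\mathcal{U}(U))$. For $U=(a,b)$ and $\varepsilon\ge 0$ let $U_\varepsilon=(a-\varepsilon,b+\varepsilon)$. An $\varepsilon$-interleaving between (pre-)cosheaves $\mathscr{F},\mathscr{G}$ consists of families of maps $\varphi_U:\mathscr{F}(U)\to\mathscr{G}(U_\varepsilon)$, $\psi_U:\mathscr{G}(U)\to\mathscr{F}(U_\varepsilon)$, natural with respect to inclusions of intervals, with $\psi_{U_\varepsilon}\circ\varphi_U=\mathscr{F}[U\subset U_{2\varepsilon}]$ and $\varphi_{U_\varepsilon}\circ\psi_U=\mathscr{G}[U\subset U_{2\varepsilon}]$ for all open intervals $U$. The interleaving distance $d_I(\mathscr{F},\mathscr{G})$ is the infimum of all $\varepsilon$ for which there is an $\varepsilon$-interleaving ($+\infty$ if there is none). The resolution of $\mathcal{U}$ relative to $\mathscr{F}$ is $\operatorname{res}_{\mathscr{F}}\mathcal{U}:=\max\{\operatorname{diam}(V): V\in\mathcal{U},\ \mathscr{F}(V)\ne\emptyset\}\in[0,+\infty]$, where unbounded intervals have diameter $+\infty$ and the maximum is understood as a supremum in $[0,+\infty]$. *)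

theory Defs
  imports "HOL-Analysis.Analysis"
begin

definition open_interval :: "real set \<Rightarrow> bool" where
  "open_interval U \<longleftrightarrow> open U \<and> connected U \<and> U \<noteq> {}"

text \<open>
  The object and structure maps of a functor from open intervals to sets. Since the open intervals
  form a set, all values can be taken as subsets of a single type. Only the values on open
  intervals, and the values of \<open>smap F U V\<close> on \<open>obj F U\<close> for \<open>U \<subseteq> V\<close>, are meaningful.
\<close>

record 'a precosheaf_data =
  obj :: "real set \<Rightarrow> 'a set"
  smap :: "real set \<Rightarrow> real set \<Rightarrow> 'a \<Rightarrow> 'a"

definition precosheaf :: "'a precosheaf_data \<Rightarrow> bool" where
  "precosheaf F \<longleftrightarrow>
     (\<forall>U V. open_interval U \<and> open_interval V \<and> U \<subseteq> V \<longrightarrow> smap F U V \<in> obj F U \<rightarrow> obj F V) \<and>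
     (\<forall>U. open_interval U \<longrightarrow> (\<forall>x\<in>obj F U. smap F U U x = x)) \<and>
     (\<forall>U V W. open_interval U \<and> open_interval V \<and> open_interval W \<and> U \<subseteq> V \<and> V \<subseteq> W \<longrightarrow>
        (\<forall>x\<in>obj F U. smap F V W (smap F U V x) = smap F U W x))"

text \<open>
  The colimit in sets of \<open>F\<close> restricted to a family \<open>\<V>\<close> of open intervals: the disjoint union of
  the \<open>obj F V\<close>, modulo the equivalence relation generated by identifying \<open>x\<close> in \<open>obj F V\<close> with its
  image in \<open>obj F W\<close> whenever \<open>V \<subseteq> W\<close>. The canonical map sends the class of \<open>(V, x)\<close> to
  \<open>smap F V U x\<close>; for a functor this value is the same for all representatives.
\<close>

definition colim_gen ::
  "'a precosheaf_data \<Rightarrow> real set set \<Rightarrow> ((real set \<times> 'a) \<times> (real set \<times> 'a)) set" where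
  "colim_gen F \<V> =
     {((V, x), (W, smap F V W x)) | V W x. V \<in> \<V> \<and> W \<in> \<V> \<and> V \<subseteq> W \<and> x \<in> obj F V}"

definition colim :: "'a precosheaf_data \<Rightarrow> real set set \<Rightarrow> (real set \<times> 'a) set set" where
  "colim F \<V> = (SIGMA V:\<V>. obj F V) // (colim_gen F \<V> \<union> (colim_gen F \<V>)\<inverse>)\<^sup>*"

definition colim_map :: "'a precosheaf_data \<Rightarrow> real set \<Rightarrow> (real set \<times> 'a) set \<Rightarrow> 'a" where
  "colim_map F U C = the_elem ((\<lambda>(V, x). smap F V U x) ` C)"

definition cosheaf_cover :: "real set set \<Rightarrow> real set \<Rightarrow> bool" where
  "cosheaf_cover \<V> U \<longleftrightarrow>
     (\<forall>V\<in>\<V>. open_interval V) \<and> \<Union>\<V> = U \<and>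
     (\<forall>\<S>. \<S> \<subseteq> \<V> \<and> finite \<S> \<and> \<S> \<noteq> {} \<and> \<Inter>\<S> \<noteq> {} \<longrightarrow> \<Inter>\<S> \<in> \<V>)"

definition cosheaf :: "'a precosheaf_data \<Rightarrow> bool" where
  "cosheaf F \<longleftrightarrow> precosheaf F \<and>
     (\<forall>U \<V>. open_interval U \<and> cosheaf_cover \<V> U \<longrightarrow>
        bij_betw (colim_map F U) (colim F \<V>) (obj F U))"

definition nice_cover :: "real set set \<Rightarrow> bool" where
  "nice_cover \<U> \<longleftrightarrow>
     (\<forall>V\<in>\<U>. open_interval V) \<and> \<Union>\<U> = UNIV \<and>
     (\<forall>\<S>. \<S> \<subseteq> \<U> \<and> \<S> \<noteq> {} \<and> \<Inter>\<S> \<noteq> {} \<longrightarrow> contractible (\<Inter>\<S>)) \<and>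
     (\<forall>x. finite {V \<in> \<U>. x \<in> V})"

definition cover_hull :: "real set set \<Rightarrow> real set \<Rightarrow> real set" where
  "cover_hull \<U> U = (\<Union>x\<in>U. \<Inter>{V \<in> \<U>. x \<in> V})"

definition mapper :: "real set set \<Rightarrow> 'a precosheaf_data \<Rightarrow> 'a precosheaf_data" where
  "mapper \<U> F =
     \<lparr>obj = (\<lambda>U. obj F (cover_hull \<U> U)),
      smap = (\<lambda>U V. smap F (cover_hull \<U> U) (cover_hull \<U> V))\<rparr>"

text \<open>
  \<open>thicken \<epsilon> (a, b) = (a - \<epsilon>, b + \<epsilon>)\<close>, where the endpoints \<open>a\<close> and \<open>b\<close> are extended reals, so that
  infinite endpoints stay put.
\<close>

definition thicken :: "real \<Rightarrow> real set \<Rightarrow> real set" where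
  "thicken \<epsilon> U = einterval ((INF x\<in>U. ereal x) - ereal \<epsilon>) ((SUP x\<in>U. ereal x) + ereal \<epsilon>)"

definition interleaving ::
  "real \<Rightarrow> 'a precosheaf_data \<Rightarrow> 'b precosheaf_data \<Rightarrow>
   (real set \<Rightarrow> 'a \<Rightarrow> 'b) \<Rightarrow> (real set \<Rightarrow> 'b \<Rightarrow> 'a) \<Rightarrow> bool" where
  "interleaving \<epsilon> F G \<phi> \<psi> \<longleftrightarrow>
     (\<forall>U. open_interval U \<longrightarrow>
        \<phi> U \<in> obj F U \<rightarrow> obj G (thicken \<epsilon> U) \<and>
        \<psi> U \<in> obj G U \<rightarrow> obj F (thicken \<epsilon> U)) \<and>
     (\<forall>U V. open_interval U \<and> open_interval V \<and> U \<subseteq> V \<longrightarrow>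
        (\<forall>x\<in>obj F U. \<phi> V (smap F U V x) = smap G (thicken \<epsilon> U) (thicken \<epsilon> V) (\<phi> U x)) \<and>
        (\<forall>y\<in>obj G U. \<psi> V (smap G U V y) = smap F (thicken \<epsilon> U) (thicken \<epsilon> V) (\<psi> U y))) \<and>
     (\<forall>U. open_interval U \<longrightarrow>
        (\<forall>x\<in>obj F U. \<psi> (thicken \<epsilon> U) (\<phi> U x) = smap F U (thicken (2 * \<epsilon>) U) x) \<and>
        (\<forall>y\<in>obj G U. \<phi> (thicken \<epsilon> U) (\<psi> U y) = smap G U (thicken (2 * \<epsilon>) U) y))"

definition interleaving_dist :: "'a precosheaf_data \<Rightarrow> 'b precosheaf_data \<Rightarrow> ennreal" where
  "interleaving_dist F G =
     Inf {ennreal \<epsilon> | \<epsilon>. 0 \<le> \<epsilon> \<and> (\<exists>\<phi> \<psi>. interleaving \<epsilon> F G \<phi> \<psi>)}"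

text \<open>
  The library's real-valued \<open>diameter\<close> is not infinite on unbounded sets, hence the extended version.
\<close>

definition ediam :: "real set \<Rightarrow> ennreal" where
  "ediam V = (SUP (x, y)\<in>V \<times> V. ennreal (dist x y))"

definition resolution :: "'a precosheaf_data \<Rightarrow> real set set \<Rightarrow> ennreal" where
  "resolution F \<U> = Sup {ediam V | V. V \<in> \<U> \<and> obj F V \<noteq> {}}"

end

theory Submission
  imports Defs
begin

text \<open>
  Put \<open>\<epsilon> = resolution F \<U>\<close>, let \<open>N x = \<Inter>{V \<in> \<U>. x \<in> V}\<close>, and write \<open>I\<close> for \<open>cover_hull \<U> U\<close>
  and \<open>J\<close> for \<open>I \<inter> thicken \<epsilon> U\<close>. A member of \<open>\<U>\<close> on which \<open>F\<close> is empty may be arbitrarily long,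
  so \<open>I\<close> need not lie in \<open>thicken \<epsilon> U\<close>; but if \<open>F (N x)\<close> is nonempty for some \<open>x \<in> U\<close>, then \<open>N x\<close>
  has diameter at most \<open>\<epsilon>\<close> and hence lies in \<open>J\<close>. Therefore the subintervals of the sets \<open>N x\<close>, and
  those of them that lie in \<open>J\<close>, have the same colimit, and the cosheaf property makes
  \<open>F J \<rightarrow> F I\<close> a bijection. Its inverse followed by \<open>F J \<rightarrow> F (thicken \<epsilon> U)\<close> is one half of an
  interleaving; the other half is the structure map
  \<open>F U \<rightarrow> F (cover_hull \<U> (thicken \<epsilon> U))\<close>.
\<close>

section \<open>Open intervals and thickenings\<close>

lemma open_interval_Int:
  assumes "open_interval U" "open_interval V" "U \<inter> V \<noteq> {}"
  shows "open_interval (U \<inter> V)"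
  using assms unfolding open_interval_def
  by (metis is_interval_Int is_interval_connected_1 open_Int)

lemma open_interval_Inter:
  assumes "finite \<S>" "\<S> \<noteq> {}" "\<And>V. V \<in> \<S> \<Longrightarrow> open_interval V" "\<Inter>\<S> \<noteq> {}"
  shows "open_interval (\<Inter>\<S>)"
  using assms
proof (induction \<S> rule: finite_ne_induct)
  case (insert V \<S>)
  then have "open_interval (\<Inter>\<S>)" by auto
  then show ?case
    using insert.prems open_interval_Int[of V "\<Inter>\<S>"] by auto
qed simp

lemma open_interval_less_ex:
  assumes "open_interval U" "y \<in> U"
  obtains u v where "u \<in> U" "v \<in> U" "u < y" "y < v"
proof -
  obtain e where "e > 0" "ball y e \<subseteq> U"
    using assms unfolding open_interval_def by (meson openE)
  then have "y - e/2 \<in> U" "y + e/2 \<in> U"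
    by (auto simp: subset_iff dist_real_def)
  with \<open>e > 0\<close> show thesis by (intro that[of "y - e/2" "y + e/2"]) auto
qed

text \<open>An infimum lies strictly below a bound exactly when some point of the set does, and
  dually for a supremum. This removes the extended-real endpoints, so unbounded intervals need no
  separate treatment later.\<close>

lemma mem_thicken_iff:
  "y \<in> thicken e U \<longleftrightarrow> (\<exists>u\<in>U. u < y + e) \<and> (\<exists>v\<in>U. y < v + e)"
proof -
  have "(INF x\<in>U. ereal x) - ereal e < ereal y \<longleftrightarrow> (INF x\<in>U. ereal x) < ereal (y + e)"
    by (cases "INF x\<in>U. ereal x") auto
  moreover have "ereal y < (SUP x\<in>U. ereal x) + ereal e \<longleftrightarrow> ereal (y - e) < (SUP x\<in>U. ereal x)"
    by (cases "SUP x\<in>U. ereal x") auto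
  ultimately show ?thesis
    unfolding thicken_def einterval_def
    by (auto simp: INF_less_iff less_SUP_iff algebra_simps)
qed

lemma thicken_mono: "U \<subseteq> V \<Longrightarrow> thicken e U \<subseteq> thicken e V"
  unfolding subset_iff mem_thicken_iff by blast

lemma subset_thicken:
  assumes "open_interval U" "0 \<le> e"
  shows "U \<subseteq> thicken e U"
proof
  fix y assume "y \<in> U"
  then obtain u v where "u \<in> U" "v \<in> U" "u < y" "y < v"
    using open_interval_less_ex assms(1) by metis
  moreover then have "u < y + e" "y < v + e"
    using assms(2) by auto
  ultimately show "y \<in> thicken e U"
    unfolding mem_thicken_iff by blast
qed

lemma open_interval_thicken:
  assumes "open_interval U" "0 \<le> e"
  shows "open_interval (thicken e U)"
proof -
  have "is_interval (thicken e U)"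
    unfolding is_interval_1 Ball_def mem_thicken_iff
    by (meson add_right_mono le_less_trans less_le_trans)
  moreover have "open (thicken e U)"
    unfolding thicken_def by simp
  moreover have "thicken e U \<noteq> {}"
    using subset_thicken[OF assms] assms(1) unfolding open_interval_def by auto
  ultimately show ?thesis
    by (simp add: open_interval_def is_interval_connected_1)
qed

text \<open>Used with \<open>d = e\<close>, to identify the double thickening with the
  \<open>2 * e\<close> in the definition of \<open>interleaving\<close>.\<close>

lemma thicken_thicken:
  assumes "open_interval U" "0 \<le> e"
  shows "thicken d (thicken e U) = thicken (d + e) U"
proof (intro equalityI subsetI)
  fix y assume "y \<in> thicken d (thicken e U)"
  then obtain u v where "u < y + d" "u \<in> thicken e U" "y < v + d" "v \<in> thicken e U"
    unfolding mem_thicken_iff[of y d] by blast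
  moreover then obtain u' v' where "u' \<in> U" "u' < u + e" "v' \<in> U" "v < v' + e"
    unfolding mem_thicken_iff by blast
  ultimately have "u' < y + (d + e)" "y < v' + (d + e)" by auto
  with \<open>u' \<in> U\<close> \<open>v' \<in> U\<close> show "y \<in> thicken (d + e) U"
    unfolding mem_thicken_iff by blast
next
  fix y assume "y \<in> thicken (d + e) U"
  then obtain u v where uv: "u \<in> U" "u < y + (d + e)" "v \<in> U" "y < v + (d + e)"
    unfolding mem_thicken_iff by blast
  \<comment> \<open>The intermediate points \<open>w\<close> and \<open>w'\<close> will be chosen
    above \<open>u - e\<close> and below \<open>v + e\<close>. Each must also satisfy the opposite
    inequality for membership in \<open>thicken e U\<close>. The points \<open>u'\<close> and
    \<open>v'\<close> provide it, and their strictness leaves room even when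
    \<open>e = 0\<close>.\<close>
  obtain u' where u': "u' \<in> U" "u < u'"
    using open_interval_less_ex assms uv(1) by metis
  obtain v' where v': "v' \<in> U" "v' < v"
    using open_interval_less_ex assms uv(3) by metis
  have "u - e < min (y + d) (u' + e)" "max (y - d) (v' - e) < v + e"
    using uv u' v' assms(2) by auto
  then obtain w w' where "u - e < w" "w < min (y + d) (u' + e)" "max (y - d) (v' - e) < w'" "w' < v + e"
    using dense by metis
  then have "w < y + d" "y < w' + d" "u < w + e" "w < u' + e" "v' < w' + e" "w' < v + e"
    by auto
  moreover from this have "w \<in> thicken e U" "w' \<in> thicken e U"
    using uv u' v' unfolding mem_thicken_iff by blast+
  ultimately show "y \<in> thicken d (thicken e U)"
    unfolding mem_thicken_iff[of y d] by blast
qed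

section \<open>Colimits and structure maps\<close>

lemma precosheaf_smap_in:
  assumes "precosheaf F" "open_interval U" "open_interval V" "U \<subseteq> V" "x \<in> obj F U"
  shows "smap F U V x \<in> obj F V"
proof -
  have "smap F U V \<in> obj F U \<rightarrow> obj F V"
    using assms(1)[unfolded precosheaf_def, THEN conjunct1] assms(2-4) by simp
  with assms(5) show ?thesis by (rule funcset_mem[rotated])
qed

lemma precosheaf_smap_smap:
  assumes "precosheaf F" "open_interval U" "open_interval V" "open_interval W"
    and "U \<subseteq> V" "V \<subseteq> W" "x \<in> obj F U"
  shows "smap F V W (smap F U V x) = smap F U W x"
  using assms(1)[unfolded precosheaf_def, THEN conjunct2, THEN conjunct2] assms(2-7) by simp

text \<open>Functoriality makes the value the same at both ends of a generating pair, hence constant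
  on each class. The image in \<open>colim_map\<close> is thus a singleton, so
  \<open>the_elem\<close> returns its one value.\<close>

lemma colim_map_Image:
  assumes F: "precosheaf F" and U: "open_interval U"
    and \<V>: "\<And>V. V \<in> \<V> \<Longrightarrow> open_interval V \<and> V \<subseteq> U"
    and V: "V \<in> \<V>" "x \<in> obj F V"
  shows "colim_map F U ((colim_gen F \<V> \<union> (colim_gen F \<V>)\<inverse>)\<^sup>* `` {(V, x)}) = smap F V U x"
proof -
  let ?r = "colim_gen F \<V> \<union> (colim_gen F \<V>)\<inverse>"
  let ?f = "\<lambda>(V, x). smap F V U x"
  have "?f p = ?f q" if "(p, q) \<in> colim_gen F \<V>" for p q
    using that precosheaf_smap_smap[OF F _ _ U] \<V> unfolding colim_gen_def by fastforce
  then have gen: "?f p = ?f q" if "(p, q) \<in> ?r" for p q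
    using that by fastforce
  have "?f p = ?f q" if "(p, q) \<in> ?r\<^sup>*" for p q
    using that
  proof (induction rule: rtrancl_induct)
    case (step q q')
    then show ?case using gen[of q q'] by argo
  qed simp
  then have "?f ` (?r\<^sup>* `` {(V, x)}) = {?f (V, x)}"
    by (fastforce intro: rtrancl_refl)
  then show ?thesis
    unfolding colim_map_def by (simp only: the_elem_eq prod.case)
qed

text \<open>Intervals on which \<open>F\<close> is empty contribute nothing to a colimit. The part
  of the cover of \<open>K\<close> that lies in \<open>J\<close> therefore has the same colimit, and
  the cosheaf property identifies this one set with both \<open>obj F J\<close> and
  \<open>obj F K\<close>.\<close>

lemma bij_betw_smap:
  assumes F: "cosheaf F" and J: "open_interval J" and K: "open_interval K" and "J \<subseteq> K"
    and \<N>: "\<And>N. N \<in> \<N> \<Longrightarrow> open_interval N" "\<Union>\<N> = K"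
    and small: "\<And>N. N \<in> \<N> \<Longrightarrow> obj F N \<noteq> {} \<Longrightarrow> N \<subseteq> J"
  shows "bij_betw (smap F J K) (obj F J) (obj F K)"
proof -
  have pF: "precosheaf F"
    using F by (simp add: cosheaf_def)
  \<comment> \<open>Passing to all subintervals makes the cover closed under nonempty finite
    intersections. It also ensures that the members inside \<open>J\<close> still cover
    \<open>J\<close>, through the sets \<open>N \<inter> J\<close>.\<close>
  define \<V> where "\<V> = {W. open_interval W \<and> (\<exists>N\<in>\<N>. W \<subseteq> N)}"
  define \<W> where "\<W> = {W \<in> \<V>. W \<subseteq> J}"
  have \<V>_open: "open_interval W" if "W \<in> \<V>" for W
    using that by (simp add: \<V>_def)
  have \<V>_I: "W \<in> \<V>" if "open_interval W" "W \<subseteq> V" "V \<in> \<V>" for W V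
    using that unfolding \<V>_def by auto
  have Inter: "\<Inter>\<S> \<in> \<V>"
    if \<S>: "\<S> \<subseteq> \<V>" "finite \<S>" "\<S> \<noteq> {}" "\<Inter>\<S> \<noteq> {}" for \<S>
  proof -
    obtain V where "V \<in> \<S>" using \<S>(3) by blast
    moreover have "open_interval (\<Inter>\<S>)"
      using \<S> \<V>_open by (intro open_interval_Inter) auto
    ultimately show ?thesis
      using \<V>_I[OF _ Inter_lower] \<S>(1) by blast
  qed
  have "\<N> \<subseteq> \<V>"
    unfolding \<V>_def using \<N>(1) by blast
  have cover_\<V>: "cosheaf_cover \<V> K"
    unfolding cosheaf_cover_def
  proof (intro conjI allI impI)
    have "\<Union>\<V> \<subseteq> K" unfolding \<V>_def \<N>(2)[symmetric] by blast
    with \<open>\<N> \<subseteq> \<V>\<close> \<N>(2) show "\<Union>\<V> = K" by blast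
  qed (auto intro: \<V>_open Inter simp del: Inter_iff)
  have cover_\<W>: "cosheaf_cover \<W> J"
    unfolding cosheaf_cover_def
  proof (intro conjI allI impI ballI)
    show "open_interval W" if "W \<in> \<W>" for W
      using that \<V>_open by (simp add: \<W>_def)
    have "x \<in> \<Union>\<W>" if x: "x \<in> J" for x
    proof -
      obtain N where N: "N \<in> \<N>" "x \<in> N"
        using x \<open>J \<subseteq> K\<close> \<N>(2) by blast
      then have "open_interval (N \<inter> J)"
        using open_interval_Int[OF \<N>(1) J] x by blast
      then have "N \<inter> J \<in> \<W>"
        using \<V>_I[of "N \<inter> J" N] N(1) \<open>\<N> \<subseteq> \<V>\<close> by (auto simp: \<W>_def)
      with N(2) x show ?thesis by blast
    qed
    then show "\<Union>\<W> = J" unfolding \<W>_def by blast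
    fix \<S> assume "\<S> \<subseteq> \<W> \<and> finite \<S> \<and> \<S> \<noteq> {} \<and> \<Inter>\<S> \<noteq> {}"
    then have \<S>: "\<S> \<subseteq> \<W>" "finite \<S>" "\<S> \<noteq> {}" "\<Inter>\<S> \<noteq> {}" by simp_all
    have "\<S> \<subseteq> \<V>" using \<S>(1) by (auto simp: \<W>_def)
    then have "\<Inter>\<S> \<in> \<V>" using \<S> by (intro Inter)
    moreover have "\<Inter>\<S> \<subseteq> J"
      using \<S>(1,3) unfolding \<W>_def by blast
    ultimately show "\<Inter>\<S> \<in> \<W>" by (simp add: \<W>_def)
  qed
  \<comment> \<open>An element over \<open>W\<close> would map to an element over some
    \<open>N\<close> containing \<open>W\<close>, and \<open>small\<close> would then put
    \<open>W\<close> inside \<open>J\<close>.\<close>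
  have "obj F W = {}" if W: "W \<in> \<V>" "W \<notin> \<W>" for W
  proof (rule ccontr)
    assume ne: "obj F W \<noteq> {}"
    obtain N where N: "N \<in> \<N>" "W \<subseteq> N" "open_interval W"
      using W(1) unfolding \<V>_def by blast
    then have "obj F N \<noteq> {}"
      using precosheaf_smap_in[OF pF] \<N>(1) ne by blast
    with N small have "W \<subseteq> J" by blast
    with W show False by (simp add: \<W>_def)
  qed
  moreover have sub: "\<W> \<subseteq> \<V>" by (auto simp: \<W>_def)
  moreover have smap_in: "smap F V W x \<in> obj F W"
    if "V \<in> \<V>" "W \<in> \<V>" "V \<subseteq> W" "x \<in> obj F V" for V W x
    using that by (intro precosheaf_smap_in[OF pF]) (auto simp: \<V>_def)
  ultimately have obj_iff: "W \<in> \<V> \<and> x \<in> obj F W \<longleftrightarrow> W \<in> \<W> \<and> x \<in> obj F W" for W x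
    by blast
  have Sigma_eq: "(SIGMA V:\<V>. obj F V) = (SIGMA V:\<W>. obj F V)"
    using obj_iff by auto
  \<comment> \<open>Both ends of a generating pair carry an element, namely \<open>x\<close> and its
    image, so both intervals already belong to \<open>\<W>\<close>.\<close>
  have "V \<in> \<V> \<and> W \<in> \<V> \<and> V \<subseteq> W \<and> x \<in> obj F V \<longleftrightarrow>
      V \<in> \<W> \<and> W \<in> \<W> \<and> V \<subseteq> W \<and> x \<in> obj F V" for V W x
    using obj_iff smap_in sub by (meson subsetD)
  then have gen_eq: "colim_gen F \<V> = colim_gen F \<W>"
    unfolding colim_gen_def by simp
  have colim_eq: "colim F \<V> = colim F \<W>"
    unfolding colim_def Sigma_eq gen_eq ..
  have map_eq: "colim_map F K C = (smap F J K \<circ> colim_map F J) C" if mem: "C \<in> colim F \<W>" for C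
  proof -
    obtain W x where W: "W \<in> \<W>" "x \<in> obj F W"
      and C: "C = (colim_gen F \<W> \<union> (colim_gen F \<W>)\<inverse>)\<^sup>* `` {(W, x)}"
      using mem unfolding colim_def quotient_def by blast
    have sub_J: "open_interval V \<and> V \<subseteq> J" if "V \<in> \<W>" for V
      using that unfolding \<W>_def \<V>_def by blast
    have "colim_map F J C = smap F W J x"
      unfolding C using pF J W sub_J by (intro colim_map_Image) auto
    moreover have "colim_map F K C = smap F W K x"
      unfolding C using pF K W sub_J \<open>J \<subseteq> K\<close> by (intro colim_map_Image) blast+
    moreover have "smap F J K (smap F W J x) = smap F W K x"
      using precosheaf_smap_smap[OF pF _ J K] W sub_J \<open>J \<subseteq> K\<close> by blast
    ultimately show ?thesis by simp
  qed
  have "bij_betw (colim_map F J) (colim F \<W>) (obj F J)"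
    using F J cover_\<W> unfolding cosheaf_def by blast
  moreover have "bij_betw (colim_map F K) (colim F \<W>) (obj F K)"
    using F K cover_\<V> colim_eq unfolding cosheaf_def by metis
  moreover have "bij_betw (colim_map F K) (colim F \<W>) (obj F K) \<longleftrightarrow>
      bij_betw (smap F J K \<circ> colim_map F J) (colim F \<W>) (obj F K)"
    by (rule bij_betw_cong) (rule map_eq)
  \<comment> \<open>Two out of three: \<open>smap F J K\<close> composed with one bijection is
    another bijection.\<close>
  ultimately show ?thesis
    by (simp only: bij_betw_comp_iff)
qed

section \<open>Hulls with respect to a nice cover\<close>

text \<open>Local finiteness makes this a finite intersection, which keeps it open.\<close>

lemma open_interval_cover_point:
  assumes "nice_cover \<U>"
  shows "open_interval (\<Inter>{V \<in> \<U>. x \<in> V})"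
proof (rule open_interval_Inter)
  show "finite {V \<in> \<U>. x \<in> V}" "{V \<in> \<U>. x \<in> V} \<noteq> {}"
    using assms unfolding nice_cover_def by auto
  show "open_interval V" if "V \<in> {V \<in> \<U>. x \<in> V}" for V
    using that assms unfolding nice_cover_def by simp
  have "x \<in> \<Inter>{V \<in> \<U>. x \<in> V}" by simp
  then show "\<Inter>{V \<in> \<U>. x \<in> V} \<noteq> {}" by blast
qed

lemma subset_cover_hull: "U \<subseteq> cover_hull \<U> U"
  unfolding cover_hull_def by blast

lemma cover_hull_mono: "U \<subseteq> V \<Longrightarrow> cover_hull \<U> U \<subseteq> cover_hull \<U> V"
  unfolding cover_hull_def by blast

lemma open_interval_cover_hull:
  assumes "nice_cover \<U>" "open_interval U"
  shows "open_interval (cover_hull \<U> U)"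
proof -
  let ?N = "\<lambda>x. \<Inter>{V \<in> \<U>. x \<in> V}"
  have N: "open (?N x)" "connected (?N x)" for x
    using open_interval_cover_point[OF assms(1)] unfolding open_interval_def by auto
  \<comment> \<open>Adding \<open>U\<close> to every piece changes nothing in the union but gives
    all the connected pieces common points.\<close>
  have "cover_hull \<U> U = (\<Union>x\<in>U. U \<union> ?N x)"
    unfolding cover_hull_def by blast
  moreover have "connected (\<Union>x\<in>U. U \<union> ?N x)"
  proof (rule connected_Union)
    show "connected S" if "S \<in> (\<lambda>x. U \<union> ?N x) ` U" for S
      using that assms(2) N(2) unfolding open_interval_def
      by (auto intro!: connected_Un simp del: Inter_iff)
    show "\<Inter>((\<lambda>x. U \<union> ?N x) ` U) \<noteq> {}"
      using assms(2) unfolding open_interval_def by blast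
  qed
  moreover have "open (cover_hull \<U> U)"
    unfolding cover_hull_def using N(1) by blast
  ultimately show ?thesis
    using subset_cover_hull[of U \<U>] assms(2) unfolding open_interval_def by auto
qed

section \<open>Comparing hulls with thickenings\<close>

lemma subset_thicken_ediam:
  assumes "open_interval V" "ediam V \<le> ennreal e" "0 \<le> e" "x \<in> V" "x \<in> U"
  shows "V \<subseteq> thicken e U"
proof
  fix y assume "y \<in> V"
  have near: "dist x z \<le> e" if "z \<in> V" for z
  proof -
    have "ennreal (dist x z) \<le> ediam V"
      unfolding ediam_def using assms(4) that by (intro SUP_upper2[of "(x, z)"]) auto
    with assms(2,3) show ?thesis
      by (metis ennreal_le_iff order_trans)
  qed
  \<comment> \<open>The diameter gives only weak inequalities. Points of \<open>V\<close> on either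
    side of \<open>y\<close> make them strict, as membership in the open thickening
    requires.\<close>
  obtain u v where "u \<in> V" "v \<in> V" "u < y" "y < v"
    using open_interval_less_ex \<open>y \<in> V\<close> assms(1) by metis
  then have "x < y + e" "y < x + e"
    using near[of u] near[of v] unfolding dist_real_def by linarith+
  with assms(5) show "y \<in> thicken e U"
    unfolding mem_thicken_iff by blast
qed

text \<open>An instance of \<open>bij_betw_smap\<close> whose covering family consists of the sets
  \<open>?N x\<close> with \<open>x \<in> U\<close>; the resolution supplies the condition
  \<open>small\<close>.\<close>

lemma bij_betw_smap_cover_hull:
  assumes \<U>: "nice_cover \<U>" and F: "cosheaf F" and U: "open_interval U"
    and e: "resolution F \<U> = ennreal e" "0 \<le> e"
  defines "J \<equiv> cover_hull \<U> U \<inter> thicken e U"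
  shows "open_interval J" "bij_betw (smap F J (cover_hull \<U> U)) (obj F J) (obj F (cover_hull \<U> U))"
proof -
  let ?N = "\<lambda>x. \<Inter>{V \<in> \<U>. x \<in> V}"
  have pF: "precosheaf F"
    using F by (simp add: cosheaf_def)
  have "U \<subseteq> J"
    unfolding J_def using subset_cover_hull[of U \<U>] subset_thicken[OF U e(2)] by blast
  then show J: "open_interval J"
    unfolding J_def using U open_interval_thicken[OF U e(2)] open_interval_cover_hull[OF \<U> U]
    by (intro open_interval_Int) (auto simp: open_interval_def)
  show "bij_betw (smap F J (cover_hull \<U> U)) (obj F J) (obj F (cover_hull \<U> U))"
  proof (rule bij_betw_smap[where \<N> = "?N ` U"])
    fix N assume "N \<in> ?N ` U" and ne: "obj F N \<noteq> {}"
    then obtain x where x: "x \<in> U" "N = ?N x" by blast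
    have "x \<in> \<Union>\<U>" using \<U> unfolding nice_cover_def by simp
    then obtain V where V: "V \<in> \<U>" "x \<in> V" by blast
    have "open_interval V" using \<U> V unfolding nice_cover_def by simp
    moreover have "N \<subseteq> V" using V x by blast
    moreover have "open_interval N" using open_interval_cover_point[OF \<U>] x by blast
    \<comment> \<open>The resolution bounds the diameters of members of \<open>\<U>\<close>, so
      nonemptiness is pushed forward from \<open>N\<close> to a member \<open>V\<close> containing
      it.\<close>
    ultimately have "obj F V \<noteq> {}"
      using precosheaf_smap_in[OF pF] ne by blast
    then have "ediam V \<le> resolution F \<U>"
      unfolding resolution_def using V by (intro Sup_upper) blast
    then have "V \<subseteq> thicken e U"
      using e V x \<open>open_interval V\<close> by (intro subset_thicken_ediam) auto
    moreover have "N \<subseteq> cover_hull \<U> U"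
      unfolding cover_hull_def using x by blast
    ultimately show "N \<subseteq> J" unfolding J_def using \<open>N \<subseteq> V\<close> by blast
  next
    show "\<Union> (?N ` U) = cover_hull \<U> U" unfolding cover_hull_def ..
    show "open_interval N" if "N \<in> ?N ` U" for N
      using that open_interval_cover_point[OF \<U>] by blast
    show "J \<subseteq> cover_hull \<U> U" unfolding J_def by blast
  qed (fact F J open_interval_cover_hull[OF \<U> U])+
qed

section \<open>The interleaving and the distance bound\<close>

lemma interleaving_mapper:
  assumes \<U>: "nice_cover \<U>" and F: "cosheaf F"
    and e: "resolution F \<U> = ennreal e" "0 \<le> e"
  defines "J \<equiv> \<lambda>U. cover_hull \<U> U \<inter> thicken e U"
  shows "interleaving e F (mapper \<U> F)
    (\<lambda>U. smap F U (cover_hull \<U> (thicken e U)))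
    (\<lambda>U y. smap F (J U) (thicken e U) (inv_into (obj F (J U)) (smap F (J U) (cover_hull \<U> U)) y))"
    (is "interleaving e F _ ?\<phi> ?\<psi>")
proof -
  let ?I = "cover_hull \<U>" and ?T = "thicken e"
  have pF: "precosheaf F"
    using F by (simp add: cosheaf_def)
  note smap_in = precosheaf_smap_in[OF pF] and smap_smap = precosheaf_smap_smap[OF pF]
  note T = open_interval_thicken[OF _ e(2)] and I = open_interval_cover_hull[OF \<U>]
  have J: "open_interval (J U)"
    and bij: "bij_betw (smap F (J U) (?I U)) (obj F (J U)) (obj F (?I U))"
    if "open_interval U" for U
    using bij_betw_smap_cover_hull[OF \<U> F that e] unfolding J_def by blast+
  have sub: "J U \<subseteq> ?I U" "J U \<subseteq> ?T U" for U
    unfolding J_def by auto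
  have UJ: "U \<subseteq> J U" if "open_interval U" for U
    unfolding J_def using subset_cover_hull subset_thicken[OF that e(2)] by blast
  have J_mono: "J U \<subseteq> J V" if "U \<subseteq> V" for U V
    unfolding J_def using cover_hull_mono[OF that] thicken_mono[OF that] by blast
  have TT: "?T (?T U) = thicken (2 * e) U" if "open_interval U" for U
    unfolding mult_2 using that e(2) by (rule thicken_thicken)
  have UT: "U \<subseteq> ?T U" if "open_interval U" for U
    using subset_thicken[OF that e(2)] .
  \<comment> \<open>This is all that is needed about the inverse. Together with \<open>lift\<close>
    it expresses \<open>?\<psi>\<close> through an element \<open>z\<close> over \<open>J U\<close>,
    which reduces each identity below to functoriality of \<open>F\<close>.\<close>
  have \<psi>: "?\<psi> U (smap F (J U) (?I U) z) = smap F (J U) (?T U) z"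
    if "open_interval U" "z \<in> obj F (J U)" for U z
    using bij_betw_inv_into_left[OF bij] that by simp
  have lift: "\<exists>z\<in>obj F (J U). y = smap F (J U) (?I U) z"
    if "open_interval U" "y \<in> obj F (?I U)" for U y
    using bij[OF that(1)] that(2) unfolding bij_betw_def by blast
  have "?\<phi> U \<in> obj F U \<rightarrow> obj (mapper \<U> F) (?T U)" if U: "open_interval U" for U
    using smap_in[OF U I[OF T[OF U]]] UT[OF U] subset_cover_hull unfolding mapper_def by force
  moreover have "?\<psi> U \<in> obj (mapper \<U> F) U \<rightarrow> obj F (?T U)" if U: "open_interval U" for U
  proof
    fix y assume "y \<in> obj (mapper \<U> F) U"
    then obtain z where z: "z \<in> obj F (J U)" "y = smap F (J U) (?I U) z"
      using lift[OF U] unfolding mapper_def by auto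
    then show "?\<psi> U y \<in> obj F (?T U)"
      using \<psi>[OF U z(1)] smap_in[OF J[OF U] T[OF U] sub(2) z(1)] by simp
  qed
  moreover have "?\<phi> V (smap F U V x) = smap (mapper \<U> F) (?T U) (?T V) (?\<phi> U x)"
    if U: "open_interval U" and V: "open_interval V" and "U \<subseteq> V" "x \<in> obj F U" for U V x
  proof -
    have "U \<subseteq> ?I (?T U)" "V \<subseteq> ?I (?T V)"
      using UT U V subset_cover_hull by blast+
    moreover have "?I (?T U) \<subseteq> ?I (?T V)"
      using \<open>U \<subseteq> V\<close> by (intro cover_hull_mono thicken_mono)
    ultimately show ?thesis
      using that I T smap_smap by (simp add: mapper_def)
  qed
  moreover have "?\<psi> V (smap (mapper \<U> F) U V y) = smap F (?T U) (?T V) (?\<psi> U y)"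
    if U: "open_interval U" and V: "open_interval V" and UV: "U \<subseteq> V"
      and y: "y \<in> obj (mapper \<U> F) U" for U V y
  proof -
    obtain z where z: "z \<in> obj F (J U)" "y = smap F (J U) (?I U) z"
      using lift[OF U] y unfolding mapper_def by auto
    \<comment> \<open>The lift of the image of \<open>y\<close> is the image of the lift
      \<open>z\<close>, since both routes from \<open>J U\<close> to \<open>?I V\<close> are the
      same structure map.\<close>
    have "smap (mapper \<U> F) U V y = smap F (J V) (?I V) (smap F (J U) (J V) z)"
      using z I J U V sub J_mono[OF UV] cover_hull_mono[OF UV] by (simp add: mapper_def smap_smap)
    moreover have "smap F (J U) (J V) z \<in> obj F (J V)"
      using z J U V J_mono[OF UV] by (intro smap_in)
    ultimately have "?\<psi> V (smap (mapper \<U> F) U V y) = smap F (J V) (?T V) (smap F (J U) (J V) z)"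
      using \<psi>[OF V] by simp
    also have "\<dots> = smap F (?T U) (?T V) (smap F (J U) (?T U) z)"
      using z T J U V sub J_mono[OF UV] thicken_mono[OF UV] by (simp add: smap_smap)
    finally show ?thesis
      using \<psi>[OF U z(1)] z(2) by simp
  qed
  moreover have "?\<psi> (?T U) (?\<phi> U x) = smap F U (thicken (2 * e) U) x"
    if U: "open_interval U" and x: "x \<in> obj F U" for U x
  proof -
    have UJT: "U \<subseteq> J (?T U)"
      using UT[OF U] UJ[OF T[OF U]] by blast
    \<comment> \<open>Factoring \<open>?\<phi>\<close> through \<open>J (?T U)\<close> exhibits a
      lift of its value, which \<open>?\<psi>\<close> then sends on to
      \<open>?T (?T U)\<close>.\<close>
    then have "?\<phi> U x = smap F (J (?T U)) (?I (?T U)) (smap F U (J (?T U)) x)"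
      using x U T I J sub by (simp add: smap_smap)
    moreover have "smap F U (J (?T U)) x \<in> obj F (J (?T U))"
      by (intro smap_in J T U x UJT)
    ultimately have "?\<psi> (?T U) (?\<phi> U x) = smap F (J (?T U)) (?T (?T U)) (smap F U (J (?T U)) x)"
      using \<psi>[OF T[OF U]] by simp
    also have "\<dots> = smap F U (?T (?T U)) x"
      using x U T J UJT sub by (simp add: smap_smap)
    finally show ?thesis using TT[OF U] by simp
  qed
  moreover have "?\<phi> (?T U) (?\<psi> U y) = smap (mapper \<U> F) U (thicken (2 * e) U) y"
    if U: "open_interval U" and y: "y \<in> obj (mapper \<U> F) U" for U y
  proof -
    obtain z where z: "z \<in> obj F (J U)" "y = smap F (J U) (?I U) z"
      using lift[OF U] y unfolding mapper_def by auto
    have "U \<subseteq> ?T (?T U)" "?T U \<subseteq> ?T (?T U)" using UT U T by blast+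
    then have "?I U \<subseteq> ?I (?T (?T U))" "?T U \<subseteq> ?I (?T (?T U))"
      using cover_hull_mono subset_cover_hull by blast+
    \<comment> \<open>Both sides are the structure map from \<open>J U\<close> to
      \<open>?I (?T (?T U))\<close> applied to \<open>z\<close>, once through \<open>?T U\<close>
      and once through \<open>?I U\<close>.\<close>
    then have "smap F (?T U) (?I (?T (?T U))) (smap F (J U) (?T U) z)
        = smap F (?I U) (?I (?T (?T U))) (smap F (J U) (?I U) z)"
      using z U T I J sub by (simp add: smap_smap)
    then show ?thesis
      using \<psi>[OF U z(1)] z(2) TT[OF U] by (simp add: mapper_def)
  qed
  ultimately show ?thesis
    unfolding interleaving_def by blast
qed

theorem theorem2p27:
  fixes \<U> :: "real set set" and F :: "'a precosheaf_data"
  assumes "nice_cover \<U>" and "cosheaf F"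
  shows "interleaving_dist F (mapper \<U> F) \<le> resolution F \<U>"
\<comment> \<open>An infinite resolution makes the bound trivial; a finite one is itself an
  admissible interleaving parameter.\<close>
proof (cases "resolution F \<U>" rule: ennreal_cases)
  case (real e)
  then have "\<exists>\<phi> \<psi>. interleaving e F (mapper \<U> F) \<phi> \<psi>"
    using interleaving_mapper[OF assms] by blast
  with real show ?thesis
    unfolding interleaving_dist_def by (intro Inf_lower) auto
qed simp

end
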